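(* Let $\mathfrak{J}=\{J_1,\dots,J_m\}$ be a finite collection of mutually exterior bounded Jordan curves in $\hat{\mathbb{C}}$ and let $\delta>0$ be a real number. Then there exists a rational map $Q:\hat{\mathbb{C}}\to\hat{\mathbb{C}}$ for which $\infty$ is an attracting fixed point and (i) $d_H(\mathfrak{J}_0,\mathcal{K}(Q))<\delta$; (ii) $d_H(\mathfrak{J}_+,\mathcal{J}(Q))<\delta$; and (iii) $d_H(\mathfrak{J}_\infty,\mathcal{L}(Q))<\delta$.
   Context: $\hat{\mathbb{C}}=\mathbb{C}\cup\{\infty\}$ is the Riemann sphere. For a rational map $f$ of $\hat{\mathbb{C}}$ for which $\infty$ is an attracting fixed point: $\mathcal{L}(f)$ is the basin of attraction of $\infty$ for $f$ (the set of points whose forward iterates converge to $\infty$), $\mathcal{K}(f)=\hat{\mathbb{C}}\setminus\mathcal{L}(f)$, and $\mathcal{J}(f)=\partial\mathcal{K}(f)$. Jordan curves $J_1,\dots,J_m$ that are bounded (contained in $\mathbb{C}$) are mutually exterior if, for all $i\neq j$, $J_j$ is disjoint from the union of $J_i$ and the bounded component of $\hat{\mathbb{C}}\setminus J_i$. For such a collection $\mathfrak{J}$: $\mathfrak{J}_+=\bigcup_i J_i$; $\mathfrak{J}_0$ is the union over $i$ of the bounded connected components of $\hat{\mathbb{C}}\setminus J_i$; and $\mathfrak{J}_\infty=\hat{\mathbb{C}}\setminus(\mathfrak{J}_+\cup\mathfrak{J}_0)$. For nonempty $X,Y\subset\mathbb{C}$, the Hausdorff distance is $d_H(X,Y)=\inf\{\epsilon>0: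 X\subseteq N_\epsilon(Y)\text{ and }Y\subseteq N_\epsilon(X)\}$, where $N_\epsilon(X)=\bigcup_{x\in X}\{z: d(z,x)\le\epsilon\}$ and $d$ is the Euclidean distance. If $X,Y\subset\hat{\mathbb{C}}$ both contain an open ball about $\infty$, then $d_H(X,Y)$ means $d_H(X\setminus B,Y\setminus B)$, where $B=\{|z|>R\}\cup\{\infty\}$ is a sufficiently small such ball (i.e. $R$ sufficiently large) contained in both $X$ and $Y$; the value does not depend on $R$ once $R$ is large enough. *)

theory Defs
  imports "HOL-Analysis.Analysis" "HOL-Computational_Algebra.Polynomial"
begin

section \<open>The Riemann sphere\<close>

text \<open>The point at infinity is \<^term>\<open>None\<close>; the finite points are \<^term>\<open>Some z\<close>.\<close>

type_synonym csphere = "complex option"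

abbreviation riemann_sphere :: "csphere topology" where
  "riemann_sphere \<equiv> Alexandroff_compactification (euclidean :: complex topology)"

definition sphere_inversion :: "csphere \<Rightarrow> csphere" where
  "sphere_inversion w =
     (case w of None \<Rightarrow> Some 0 | Some z \<Rightarrow> if z = 0 then None else Some (1 / z))"

section \<open>Rational maps with an attracting fixed point at infinity\<close>

text \<open>With \<open>N = max (degree p) (degree q)\<close>, the value of \<open>p / q\<close> at infinity is the quotient
  of the two coefficients of index \<open>N\<close>, which do not both vanish. The condition \<open>q \<noteq> 0\<close>
  excludes the map that is constantly infinite.\<close>

definition rational_map_of :: "complex poly \<Rightarrow> complex poly \<Rightarrow> csphere \<Rightarrow> csphere" where
  "rational_map_of p q w =
     (case w of
        Some z \<Rightarrow> if poly q z = 0 then None else Some (poly p z / poly q z)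
      | None \<Rightarrow> (let N = max (degree p) (degree q)
                 in if coeff q N = 0 then None else Some (coeff p N / coeff q N)))"

definition is_rational_map :: "(csphere \<Rightarrow> csphere) \<Rightarrow> bool" where
  "is_rational_map f \<longleftrightarrow> (\<exists>p q. q \<noteq> 0 \<and> coprime p q \<and> f = rational_map_of p q)"

text \<open>The multiplier at infinity is the derivative at \<open>0\<close> of \<open>f\<close> read in the chart \<open>1 / z\<close>.
  Superattracting fixed points (multiplier \<open>0\<close>) count as attracting.
  If \<open>f\<close> is continuous at infinity, \<^const>\<open>the\<close> is applied to finite points only, near \<open>0\<close>.\<close>

definition attracting_fixed_point_at_infinity :: "(csphere \<Rightarrow> csphere) \<Rightarrow> bool" where
  "attracting_fixed_point_at_infinity f \<longleftrightarrow>
     f None = None \<and>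
     (\<exists>d. ((\<lambda>w. the (sphere_inversion (f (sphere_inversion (Some w)))))
             has_field_derivative d) (at 0) \<and> norm d < 1)"

definition basin_infinity :: "(csphere \<Rightarrow> csphere) \<Rightarrow> csphere set" where
  "basin_infinity f = {z. limitin riemann_sphere (\<lambda>n. (f ^^ n) z) None sequentially}"

definition filled_julia :: "(csphere \<Rightarrow> csphere) \<Rightarrow> csphere set" where
  "filled_julia f = UNIV - basin_infinity f"

definition julia :: "(csphere \<Rightarrow> csphere) \<Rightarrow> csphere set" where
  "julia f = riemann_sphere frontier_of (filled_julia f)"

section \<open>Mutually exterior Jordan curves\<close>

definition bounded_jordan_curve :: "csphere set \<Rightarrow> bool" where
  "bounded_jordan_curve J \<longleftrightarrow>
     (\<exists>g :: real \<Rightarrow> complex. simple_path g \<and> pathfinish g = pathstart g \<and> J = Some ` path_image g)"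

definition bounded_components :: "csphere set \<Rightarrow> csphere set set" where
  "bounded_components J =
     {C \<in> connected_components_of (subtopology riemann_sphere (UNIV - J)).
        \<exists>B :: complex set. bounded B \<and> C = Some ` B}"

definition mutually_exterior :: "csphere set set \<Rightarrow> bool" where
  "mutually_exterior \<J> \<longleftrightarrow>
     (\<forall>I\<in>\<J>. \<forall>J\<in>\<J>. I \<noteq> J \<longrightarrow> J \<inter> (I \<union> \<Union>(bounded_components I)) = {})"

definition curves_union :: "csphere set set \<Rightarrow> csphere set" where
  "curves_union \<J> = \<Union>\<J>"

definition curves_interior :: "csphere set set \<Rightarrow> csphere set" where
  "curves_interior \<J> = (\<Union>J\<in>\<J>. \<Union>(bounded_components J))"

definition curves_exterior :: "csphere set set \<Rightarrow> csphere set" where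
  "curves_exterior \<J> = UNIV - (curves_union \<J> \<union> curves_interior \<J>)"

section \<open>Hausdorff distance\<close>

definition closed_nbhd :: "real \<Rightarrow> complex set \<Rightarrow> complex set" where
  "closed_nbhd e X = (\<Union>x\<in>X. cball x e)"

text \<open>The values are extended reals, so that the infimum of the empty set is \<open>\<infinity>\<close>
  (in \<^typ>\<open>real\<close> that infimum would be a meaningless number).\<close>

definition hausdorff_dist :: "complex set \<Rightarrow> complex set \<Rightarrow> ennreal" where
  "hausdorff_dist X Y =
     Inf {ennreal e | e. e > 0 \<and> X \<subseteq> closed_nbhd e Y \<and> Y \<subseteq> closed_nbhd e X}"

text \<open>The second case is meant for sets that both contain a punctured ball
  \<open>{z. norm z > R}\<close> about infinity (and infinity itself); the truncated distance
  is then eventually constant in \<open>R\<close>, as shown below.\<close>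

definition sphere_hausdorff_dist :: "csphere set \<Rightarrow> csphere set \<Rightarrow> ennreal" where
  "sphere_hausdorff_dist X Y =
     (if None \<notin> X \<and> None \<notin> Y then hausdorff_dist (Some -` X) (Some -` Y)
      else (THE d. \<forall>\<^sub>F R in at_top.
              hausdorff_dist (Some -` X - {z. norm z > R}) (Some -` Y - {z. norm z > R}) = d))"

lemma truncated_subset_closed_nbhd_iff:
  fixes A B :: "complex set"
  assumes "R0 \<ge> 0" and A: "{z. norm z > R0} \<subseteq> A" and B: "{z. norm z > R0} \<subseteq> B"
    and R: "R \<ge> 3 * R0 + 1" and e: "e > 0"
  shows "A - {z. norm z > R} \<subseteq> closed_nbhd e (B - {z. norm z > R}) \<longleftrightarrow> A \<subseteq> closed_nbhd e B"
proof
  assume L: "A - {z. norm z > R} \<subseteq> closed_nbhd e (B - {z. norm z > R})"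
  show "A \<subseteq> closed_nbhd e B"
  proof
    fix x assume x: "x \<in> A"
    show "x \<in> closed_nbhd e B"
    proof (cases "norm x > R")
      case True
      then have "x \<in> B" using B R \<open>R0 \<ge> 0\<close> by auto
      then show ?thesis using e by (force simp: closed_nbhd_def)
    next
      case False
      then show ?thesis using L x by (force simp: closed_nbhd_def)
    qed
  qed
next
  assume L: "A \<subseteq> closed_nbhd e B"
  show "A - {z. norm z > R} \<subseteq> closed_nbhd e (B - {z. norm z > R})"
  proof
    fix x assume x: "x \<in> A - {z. norm z > R}"
    have "\<exists>y\<in>B. norm y \<le> R \<and> dist y x \<le> e"
    proof (cases "norm x > R0")
      case True
      then have "x \<in> B" using B by auto
      then show ?thesis using x e by (intro bexI[of _ x]) auto
    next
      case small: False
      show ?thesis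
      proof (cases "e \<ge> 2 * R0 + 1")
        case True
        define y where "y = complex_of_real (R0 + 1)"
        have ny: "norm y = R0 + 1" using \<open>R0 \<ge> 0\<close> unfolding y_def by (simp only: norm_of_real)
        have "dist y x \<le> norm y + norm x" by (simp add: dist_norm norm_triangle_ineq4)
        moreover have "y \<in> B" using ny B by auto
        ultimately show ?thesis using ny small True R \<open>R0 \<ge> 0\<close> by (intro bexI[of _ y]) auto
      next
        case False
        obtain y where y: "y \<in> B" "dist y x \<le> e" using L x by (auto simp: closed_nbhd_def)
        have "norm y \<le> norm x + dist y x"
          using norm_triangle_ineq[of x "y - x"] by (simp add: dist_norm)
        then show ?thesis using y small False R by (intro bexI[of _ y]) auto
      qed
    qed
    then show "x \<in> closed_nbhd e (B - {z. norm z > R})" by (force simp: closed_nbhd_def)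
  qed
qed

lemma sphere_hausdorff_dist_eventually:
  assumes "None \<in> X" "None \<in> Y"
    and "Some ` {z. norm z > R0} \<subseteq> X" and "Some ` {z. norm z > R0} \<subseteq> Y"
  shows "\<forall>\<^sub>F R in at_top.
    hausdorff_dist (Some -` X - {z. norm z > R}) (Some -` Y - {z. norm z > R})
      = sphere_hausdorff_dist X Y"
proof -
  let ?A = "Some -` X" and ?B = "Some -` Y" and ?r = "max R0 0"
  have A: "{z. norm z > ?r} \<subseteq> ?A" and B: "{z. norm z > ?r} \<subseteq> ?B" using assms by auto
  have "hausdorff_dist (?A - {z. norm z > R}) (?B - {z. norm z > R}) = hausdorff_dist ?A ?B"
    if "R \<ge> 3 * ?r + 1" for R
    unfolding hausdorff_dist_def
    using truncated_subset_closed_nbhd_iff[OF _ A B that]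
      truncated_subset_closed_nbhd_iff[OF _ B A that]
    by (intro arg_cong[where f = Inf] Collect_cong ex_cong1 conj_cong) auto
  then have ev: "\<forall>\<^sub>F R in at_top.
      hausdorff_dist (?A - {z. norm z > R}) (?B - {z. norm z > R}) = hausdorff_dist ?A ?B"
    unfolding eventually_at_top_linorder by blast
  have uniq: "d = hausdorff_dist ?A ?B"
    if d: "\<forall>\<^sub>F R in at_top.
      hausdorff_dist (?A - {z. norm z > R}) (?B - {z. norm z > R}) = d" for d
  proof -
    have "\<forall>\<^sub>F R :: real in at_top. d = hausdorff_dist ?A ?B"
      using d ev by eventually_elim simp
    then show ?thesis by simp
  qed
  have "(THE d. \<forall>\<^sub>F R in at_top.
      hausdorff_dist (?A - {z. norm z > R}) (?B - {z. norm z > R}) = d) = hausdorff_dist ?A ?B"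
    by (rule the1_equality) (use ev uniq in blast)+
  then have "sphere_hausdorff_dist X Y = hausdorff_dist ?A ?B"
    unfolding sphere_hausdorff_dist_def using assms by simp
  then show ?thesis using ev by simp
qed

end

theory Submission
  imports Defs "HOL-Complex_Analysis.Complex_Analysis" "HOL-Computational_Algebra.Field_as_Ring"
    "HOL-Computational_Algebra.Polynomial_Factorial"
begin

text \<open>The map is \<open>Q z = c + \<alpha> (z - c) h z\<close>, where \<open>c\<close> lies inside one of the curves, \<open>\<alpha>\<close> is a large number
  and \<open>h\<close> is a rational function that is close to \<open>0\<close> at the points inside the curves and close to \<open>1\<close>
  at the points outside, except within a small distance \<open>\<epsilon>\<close> of the curves.

  Such an \<open>h\<close> comes from winding numbers. With suitable signs, the winding numbers of the curves
  add up to the indicator function of the union of the insides, because mutually exterior curves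
  have disjoint insides. Replacing a curve by a nearby polynomial loop does not change its winding
  number about a point at distance at least \<open>\<epsilon>\<close>, and the winding number of the loop is a Cauchy integral. A
  Riemann sum of this integral is a rational function of the point, with simple poles on the loop, and
  approximates the integral uniformly away from the loop
  (\<open>Cauchy_kernel_Riemann_sum\<close>, \<open>cauchy_approximable_winding_number\<close>).

  The dynamics of \<open>Q\<close> are then forced (\<open>switch_map_dynamics\<close>). Points inside, at distance at least
  \<open>\<epsilon>\<close> from the curves, are mapped into a tiny ball about \<open>c\<close> and have bounded orbits. Points outside, at
  distance at least \<open>\<epsilon>\<close> from the curves, at least double their distance to \<open>c\<close> in every step and escape to
  infinity, where the multiplier is \<open>1 / \<alpha>\<close>. Nothing is known about the orbits that start closer to the
  curves, but this affects the three sets only near the curves.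

  What remains is plane topology. By compactness there is, near every point of the curves, a point
  inside and a point outside whose distances from the curves are bounded below
  (\<open>uniform_depth_near_boundary\<close>). For \<open>\<epsilon>\<close> below that bound, the filled Julia set and
  the basin are close to the interiors and the exterior; and a small ball about a point of the
  curves meets both of them, hence also the Julia set
  (\<open>closed_nbhd_of_set_separating_deep_points\<close>,
  \<open>closed_nbhd_of_frontier_separating_deep_points\<close>). On the sphere, all of this is read in the
  finite plane, with the Jordan curve theorem identifying the bounded components
  (\<open>Union_bounded_components_Jordan_curve\<close>).\<close>

section \<open>Riemann sums of Cauchy integrals\<close>

lemma integral_equipartition:
  fixes f :: "real \<Rightarrow> complex"
  assumes f: "continuous_on {0..1} f" and n: "n > 0" and "m \<le> n"
  shows "integral {0..real m / real n} f =
    (\<Sum>k<m. integral {real k / real n..real (Suc k) / real n} f)"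
  using \<open>m \<le> n\<close>
proof (induction m)
  case (Suc m)
  have le: "real m / real n \<le> real (Suc m) / real n" "real (Suc m) / real n \<le> 1"
    using n Suc.prems by (auto simp: divide_simps)
  have "f integrable_on {0..real (Suc m) / real n}"
    by (rule integrable_continuous_real, rule continuous_on_subset[OF f]) (use le in auto)
  then have "integral {0..real (Suc m) / real n} f
      = integral {0..real m / real n} f + integral {real m / real n..real (Suc m) / real n} f"
    using le by (intro Henstock_Kurzweil_Integration.integral_combine[symmetric]) auto
  then show ?case using Suc by simp
qed simp

text \<open>Both the curve and its derivative are bounded on the parameter interval, so on a piece of length
  \<open>h\<close> the kernel changes by \<open>O(h / d\<^sup>2)\<close> and the error on that piece is \<open>O(h\<^sup>2 / d\<^sup>2)\<close>. Only the
  distance \<open>d\<close> of \<open>z\<close> from the curve enters, which makes the estimate uniform in \<open>z\<close>.\<close>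

lemma Cauchy_kernel_Riemann_sum:
  fixes p :: "real \<Rightarrow> complex"
  assumes poly: "polynomial_function p" and d: "d > 0" and \<eta>: "\<eta> > 0"
  obtains n :: nat where "n > 0"
    "\<And>z. (\<And>t. t \<in> {0..1} \<Longrightarrow> d \<le> norm (p t - z)) \<Longrightarrow>
       norm (contour_integral p (\<lambda>w. 1 / (w - z)) -
         (\<Sum>k<n. (p (real (Suc k) / real n) - p (real k / real n)) / (p (real k / real n) - z))) \<le> \<eta>"
proof -
  obtain p' where p': "polynomial_function p'" "\<And>x. (p has_vector_derivative (p' x)) (at x)"
    using has_vector_derivative_polynomial_function[OF poly] by blast
  have cont: "continuous_on A p" "continuous_on A p'" for A
    using poly p' by (auto intro: continuous_on_polymonial_function)
  have "bounded (p' ` {0..1})"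
    using cont by (intro compact_imp_bounded compact_continuous_image) auto
  then obtain M where M: "M > 0" "\<And>t. t \<in> {0..1} \<Longrightarrow> norm (p' t) \<le> M"
    by (auto simp: bounded_pos)
  have ftc: "integral {a..b} p' = p b - p a" if "a \<le> b" for a b
    using that p' by (intro integral_unique fundamental_theorem_of_calculus)
      (auto intro: has_vector_derivative_at_within)
  have lip: "norm (p b - p a) \<le> M * (b - a)" if "0 \<le> a" "a \<le> b" "b \<le> 1" for a b
    unfolding ftc[OF that(2), symmetric] using that M
    by (intro integral_bound cont) auto
  \<comment> \<open>Each of the \<open>n\<close> pieces contributes at most \<open>M\<^sup>2 / (d\<^sup>2 * n\<^sup>2)\<close> to the error.\<close>
  obtain n :: nat where n: "real n > M\<^sup>2 / (d\<^sup>2 * \<eta>)"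
    using reals_Archimedean2 by blast
  have "M\<^sup>2 / (d\<^sup>2 * \<eta>) > 0" using M d \<eta> by simp
  then have n0: "n > 0" using n by (cases n) auto
  have "norm (contour_integral p (\<lambda>w. 1 / (w - z)) -
         (\<Sum>k<n. (p (real (Suc k) / real n) - p (real k / real n)) / (p (real k / real n) - z))) \<le> \<eta>"
    if z: "\<And>t. t \<in> {0..1} \<Longrightarrow> d \<le> norm (p t - z)" for z
  proof -
    define f where "f = (\<lambda>t. p' t / (p t - z))"
    have nz: "p t - z \<noteq> 0" if "t \<in> {0..1}" for t using z[OF that] d by auto
    have fc: "continuous_on {0..1} f"
      unfolding f_def using nz by (intro continuous_intros cont) auto
    have "contour_integral p (\<lambda>w. 1 / (w - z)) = integral {0..1} f"
      unfolding contour_integral_integral f_def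
      using vector_derivative_at[OF p'(2)] by simp
    also have "\<dots> = (\<Sum>k<n. integral {real k / real n..real (Suc k) / real n} f)"
      using integral_equipartition[OF fc n0 order_refl] n0 by simp
    finally have 1: "contour_integral p (\<lambda>w. 1 / (w - z)) = \<dots>" .
    have 2: "norm (integral {real k / real n..real (Suc k) / real n} f
        - (p (real (Suc k) / real n) - p (real k / real n)) / (p (real k / real n) - z))
        \<le> M * (M / n) / d\<^sup>2 * (1 / n)" if k: "k < n" for k
    proof -
      define a b where "a = real k / real n" and "b = real (Suc k) / real n"
      have ab: "0 \<le> a" "a \<le> b" "b \<le> 1" "b - a = 1 / n"
        using k n0 by (auto simp: a_def b_def divide_simps)
      have sub: "{a..b} \<subseteq> {0..1}" using ab by auto
      have c1: "continuous_on {a..b} f" using fc sub by (rule continuous_on_subset)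
      have c2: "continuous_on {a..b} (\<lambda>t. p' t / (p a - z))"
        using nz[of a] ab by (intro continuous_intros cont) auto
      have "integral {a..b} f - (p b - p a) / (p a - z)
          = integral {a..b} f - integral {a..b} (\<lambda>t. p' t / (p a - z))"
        using ab by (simp add: ftc)
      also have "\<dots> = integral {a..b} (\<lambda>t. f t - p' t / (p a - z))"
        using c1 c2 by (intro integral_diff[symmetric] integrable_continuous_real)
      finally have eq: "integral {a..b} f - (p b - p a) / (p a - z) = \<dots>" .
      have "norm (f t - p' t / (p a - z)) \<le> M * (M / n) / d\<^sup>2" if t: "t \<in> {a..b}" for t
      proof -
        have t1: "t \<in> {0..1}" "a \<in> {0..1}" using t ab by auto
        have "f t - p' t / (p a - z) = p' t * (p a - p t) / ((p t - z) * (p a - z))"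
          unfolding f_def using nz[OF t1(1)] nz[OF t1(2)] by (simp add: field_simps)
        then have "norm (f t - p' t / (p a - z))
            = norm (p' t) * norm (p t - p a) / (norm (p t - z) * norm (p a - z))"
          by (simp add: norm_divide norm_mult norm_minus_commute)
        also have "\<dots> \<le> M * (M / n) / (d * d)"
        proof (intro frac_le mult_mono)
          have "norm (p t - p a) \<le> M * (t - a)" using t ab by (intro lip) auto
          also have "\<dots> \<le> M * (1 / n)" using t ab M by (intro mult_left_mono) auto
          finally show "norm (p t - p a) \<le> M / n" by simp
        qed (use M z t1 d in auto)
        finally show ?thesis by (simp add: power2_eq_square)
      qed
      then have "norm (integral {a..b} (\<lambda>t. f t - p' t / (p a - z))) \<le> M * (M / n) / d\<^sup>2 * (b - a)"
        using ab by (intro integral_bound continuous_on_diff[OF c1 c2]) auto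
      then show ?thesis unfolding eq[symmetric] using ab by (simp add: a_def b_def mult_ac)
    qed
    have "norm (contour_integral p (\<lambda>w. 1 / (w - z)) -
         (\<Sum>k<n. (p (real (Suc k) / real n) - p (real k / real n)) / (p (real k / real n) - z)))
         \<le> (\<Sum>k<n. M * (M / n) / d\<^sup>2 * (1 / n))"
      unfolding 1 sum_subtractf[symmetric] by (rule sum_norm_le) (use 2 in auto)
    also have "\<dots> = M\<^sup>2 / d\<^sup>2 / n" using n0 by (simp add: power2_eq_square)
    also have "\<dots> \<le> \<eta>" using n n0 d \<eta> by (simp add: field_simps)
    finally show ?thesis .
  qed
  with n0 show ?thesis by (rule that)
qed

text \<open>A finite list of pairs of a residue and a simple pole encodes a rational function that vanishes
  at infinity; repeated poles in the list are harmless.\<close>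

definition cauchy_sum :: "(complex \<times> complex) list \<Rightarrow> complex \<Rightarrow> complex" where
  "cauchy_sum xs z = (\<Sum>(a, \<zeta>)\<leftarrow>xs. a / (z - \<zeta>))"

text \<open>The poles are confined to \<open>S\<close>, and the approximation is uniform on \<open>T\<close>, which may be unbounded.\<close>

definition cauchy_approximable :: "complex set \<Rightarrow> complex set \<Rightarrow> (complex \<Rightarrow> complex) \<Rightarrow> bool" where
  "cauchy_approximable S T f \<longleftrightarrow>
     (\<forall>\<eta>>0. \<exists>xs. snd ` set xs \<subseteq> S \<and> (\<forall>z\<in>T. norm (cauchy_sum xs z - f z) \<le> \<eta>))"

lemma cauchy_approximable_mono:
  assumes "cauchy_approximable S T f" "S \<subseteq> S'" "T' \<subseteq> T" "\<And>z. z \<in> T' \<Longrightarrow> f z = g z"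
  shows "cauchy_approximable S' T' g"
  unfolding cauchy_approximable_def
proof (intro allI impI)
  fix \<eta> :: real assume "\<eta> > 0"
  then obtain xs where "snd ` set xs \<subseteq> S" "\<forall>z\<in>T. norm (cauchy_sum xs z - f z) \<le> \<eta>"
    using assms(1) unfolding cauchy_approximable_def by blast
  then show "\<exists>xs. snd ` set xs \<subseteq> S' \<and> (\<forall>z\<in>T'. norm (cauchy_sum xs z - g z) \<le> \<eta>)"
    using assms(2-4) by (intro exI[of _ xs]) (auto simp flip: assms(4))
qed

lemma cauchy_approximable_minus:
  assumes "cauchy_approximable S T f"
  shows "cauchy_approximable S T (\<lambda>z. - f z)"
  unfolding cauchy_approximable_def
proof (intro allI impI)
  fix \<eta> :: real assume "\<eta> > 0"
  then obtain xs where xs: "snd ` set xs \<subseteq> S" "\<forall>z\<in>T. norm (cauchy_sum xs z - f z) \<le> \<eta>"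
    using assms unfolding cauchy_approximable_def by blast
  define ys where "ys = map (\<lambda>(a, \<zeta>). (- a, \<zeta>)) xs"
  have "cauchy_sum ys z = - cauchy_sum xs z" for z
    unfolding ys_def cauchy_sum_def by (induction xs) auto
  then have "norm (cauchy_sum ys z - - f z) = norm (cauchy_sum xs z - f z)" for z
    by (metis minus_diff_minus norm_minus_cancel)
  moreover have "snd ` set ys = snd ` set xs" unfolding ys_def by force
  ultimately show "\<exists>xs. snd ` set xs \<subseteq> S \<and> (\<forall>z\<in>T. norm (cauchy_sum xs z - - f z) \<le> \<eta>)"
    using xs by (intro exI[of _ ys]) auto
qed

lemma cauchy_approximable_add:
  assumes "cauchy_approximable S T f" "cauchy_approximable S T g"
  shows "cauchy_approximable S T (\<lambda>z. f z + g z)"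
  unfolding cauchy_approximable_def
proof (intro allI impI)
  fix \<eta> :: real assume "\<eta> > 0"
  then have "\<eta> / 2 > 0" by simp
  then obtain xs ys where xs: "snd ` set xs \<subseteq> S" "\<forall>z\<in>T. norm (cauchy_sum xs z - f z) \<le> \<eta> / 2"
    and ys: "snd ` set ys \<subseteq> S" "\<forall>z\<in>T. norm (cauchy_sum ys z - g z) \<le> \<eta> / 2"
    using assms unfolding cauchy_approximable_def by meson
  have "norm (cauchy_sum (xs @ ys) z - (f z + g z)) \<le> \<eta>" if "z \<in> T" for z
  proof -
    have "cauchy_sum (xs @ ys) z - (f z + g z) = (cauchy_sum xs z - f z) + (cauchy_sum ys z - g z)"
      by (simp add: cauchy_sum_def)
    also have "norm \<dots> \<le> \<eta> / 2 + \<eta> / 2"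
      using xs ys that by (intro norm_triangle_mono) auto
    finally show ?thesis by simp
  qed
  then show "\<exists>xs. snd ` set xs \<subseteq> S \<and> (\<forall>z\<in>T. norm (cauchy_sum xs z - (f z + g z)) \<le> \<eta>)"
    using xs ys by (intro exI[of _ "xs @ ys"]) auto
qed

lemma cauchy_approximable_sum:
  assumes "finite I" "\<And>i. i \<in> I \<Longrightarrow> cauchy_approximable S T (f i)"
  shows "cauchy_approximable S T (\<lambda>z. \<Sum>i\<in>I. f i z)"
  using assms
proof (induction I rule: finite_induct)
  case empty
  show ?case unfolding cauchy_approximable_def
    by (auto intro!: exI[of _ "[]"] simp: cauchy_sum_def)
next
  case (insert i I)
  then show ?case by (simp add: cauchy_approximable_add)
qed

text \<open>A polynomial loop close to the given one has the same winding numbers about all points that are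
  not close to it, and its winding numbers are Cauchy integrals.\<close>

lemma cauchy_approximable_winding_number:
  fixes g :: "real \<Rightarrow> complex"
  assumes g: "path g" "pathfinish g = pathstart g" and \<epsilon>: "\<epsilon> > 0"
  shows "cauchy_approximable {\<zeta>. infdist \<zeta> (path_image g) < \<epsilon>}
    {z. \<epsilon> \<le> infdist z (path_image g)} (winding_number g)"
  unfolding cauchy_approximable_def
proof (intro allI impI)
  fix \<eta> :: real assume \<eta>: "\<eta> > 0"
  have "\<epsilon> / 2 > 0" using \<epsilon> by simp
  then obtain p where p: "polynomial_function p" "pathstart p = pathstart g" "pathfinish p = pathfinish g"
      and pg: "\<And>t. t \<in> {0..1} \<Longrightarrow> norm (p t - g t) < \<epsilon> / 2"
    using path_approx_polynomial_function[OF g(1)] by blast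
  have vp: "valid_path p" using p(1) by (rule valid_path_polynomial_function)
  obtain n :: nat where n: "n > 0"
    "\<And>z. (\<And>t. t \<in> {0..1} \<Longrightarrow> \<epsilon> / 2 \<le> norm (p t - z)) \<Longrightarrow>
       norm (contour_integral p (\<lambda>w. 1 / (w - z)) -
         (\<Sum>k<n. (p (real (Suc k) / real n) - p (real k / real n)) / (p (real k / real n) - z))) \<le> \<eta>"
    using Cauchy_kernel_Riemann_sum[OF p(1) \<open>\<epsilon> / 2 > 0\<close> \<eta>] by blast
  define c where "c = 1 / (2 * of_real pi * \<i>)"
  have "norm c = 1 / (2 * pi)" by (simp add: c_def norm_divide norm_mult)
  also have "\<dots> \<le> 1" using pi_gt3 by (simp add: divide_simps)
  finally have c: "norm c \<le> 1" .
  define xs where "xs = map (\<lambda>k. (- c * (p (real (Suc k) / real n) - p (real k / real n)), p (real k / real n))) [0..<n]"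
  have "cauchy_sum xs z = c * (\<Sum>k<n. (p (real (Suc k) / real n) - p (real k / real n)) / (p (real k / real n) - z))" for z
  proof -
    have "- c * u / (z - v) = c * (u / (v - z))" for u v
      by (metis (no_types, lifting) minus_diff_eq minus_divide_right minus_mult_left minus_divide_left times_divide_eq_right)
    then show ?thesis
      by (simp add: cauchy_sum_def xs_def comp_def interv_sum_list_conv_sum_set_nat atLeast0LessThan
          sum_distrib_left)
  qed
  note sum_eq = this
  have gI: "g t \<in> path_image g" if "t \<in> {0..1}" for t using that by (simp add: path_image_def)
  have "norm (cauchy_sum xs z - winding_number g z) \<le> \<eta>" if z: "\<epsilon> \<le> infdist z (path_image g)" for z
  proof -
    have gz: "\<epsilon> \<le> norm (g t - z)" if "t \<in> {0..1}" for t
      using infdist_le[OF gI[OF that], of z] z by (simp add: dist_norm norm_minus_commute)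
    have pz: "\<epsilon> / 2 \<le> norm (p t - z)" if "t \<in> {0..1}" for t
      using gz[OF that] pg[OF that] norm_triangle_ineq4[of "p t - z" "p t - g t"] by simp
    have "winding_number p z = winding_number g z"
      using g p pg gz \<epsilon> by (intro winding_number_nearby_paths_eq) (force simp: path_polynomial_function)+
    moreover have "z \<notin> path_image p" using pz \<epsilon> by (force simp: path_image_def)
    ultimately have "winding_number g z = c * contour_integral p (\<lambda>w. 1 / (w - z))"
      using winding_number_valid_path[OF vp] by (simp add: c_def)
    then have "cauchy_sum xs z - winding_number g z = c *
        ((\<Sum>k<n. (p (real (Suc k) / real n) - p (real k / real n)) / (p (real k / real n) - z))
          - contour_integral p (\<lambda>w. 1 / (w - z)))"
      by (simp add: sum_eq right_diff_distrib)
    then have "norm (cauchy_sum xs z - winding_number g z) = norm c * norm (contour_integral p (\<lambda>w. 1 / (w - z)) -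
         (\<Sum>k<n. (p (real (Suc k) / real n) - p (real k / real n)) / (p (real k / real n) - z)))"
      by (simp only: norm_mult norm_minus_commute)
    also have "\<dots> \<le> 1 * \<eta>" using c n(2)[OF pz] by (intro mult_mono) auto
    finally show ?thesis by simp
  qed
  moreover have "snd ` set xs \<subseteq> {\<zeta>. infdist \<zeta> (path_image g) < \<epsilon>}"
  proof clarsimp
    fix a \<zeta> assume "(a, \<zeta>) \<in> set xs"
    then obtain k where k: "k < n" "\<zeta> = p (real k / real n)" by (auto simp: xs_def)
    then have t: "real k / real n \<in> {0..1}" by auto
    show "infdist \<zeta> (path_image g) < \<epsilon>"
      using infdist_le[OF gI[OF t], of \<zeta>] pg[OF t] \<epsilon> by (simp add: k dist_norm)
  qed
  ultimately show "\<exists>xs. snd ` set xs \<subseteq> {\<zeta>. infdist \<zeta> (path_image g) < \<epsilon>} \<and>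
      (\<forall>z\<in>{z. \<epsilon> \<le> infdist z (path_image g)}. norm (cauchy_sum xs z - winding_number g z) \<le> \<eta>)"
    by blast
qed

section \<open>Rational maps with prescribed simple poles\<close>

lemma one_plus_cauchy_sum_as_quotient:
  "\<exists>V W :: complex poly. V \<noteq> 0 \<and> W \<noteq> 0 \<and> degree V = degree W \<and>
    (\<forall>z. z \<notin> snd ` set xs \<longrightarrow> poly W z \<noteq> 0 \<and> 1 + cauchy_sum xs z = poly V z / poly W z)"
proof (induction xs)
  case Nil
  show ?case by (intro exI[of _ 1]) (auto simp: cauchy_sum_def)
next
  case (Cons x xs)
  obtain a \<zeta> where x: "x = (a, \<zeta>)" by force
  from Cons obtain V W :: "complex poly" where VW: "V \<noteq> 0" "W \<noteq> 0" "degree V = degree W"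
    "\<And>z. z \<notin> snd ` set xs \<Longrightarrow> poly W z \<noteq> 0"
    "\<And>z. z \<notin> snd ` set xs \<Longrightarrow> 1 + cauchy_sum xs z = poly V z / poly W z"
    by blast
  define L where "L = [:- \<zeta>, 1:]"
  have L: "degree L = 1" "L \<noteq> 0" by (simp_all add: L_def)
  have "degree (smult a W) < degree (V * L)"
    using VW L degree_smult_le[of a W] by (simp add: degree_mult_eq)
  then have deg: "degree (V * L + smult a W) = degree (W * L)"
    using VW L by (simp add: degree_add_eq_left degree_mult_eq)
  have nz: "W * L \<noteq> 0" using VW L by simp
  have "V * L + smult a W \<noteq> 0"
    using deg VW L by (metis degree_0 degree_mult_eq add_is_0 one_neq_zero)
  moreover have "poly (W * L) z \<noteq> 0 \<and> 1 + cauchy_sum (x # xs) z = poly (V * L + smult a W) z / poly (W * L) z"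
    if "z \<notin> snd ` set (x # xs)" for z
  proof -
    have z: "z - \<zeta> \<noteq> 0" "z \<notin> snd ` set xs" using that by (auto simp: x)
    have "1 + cauchy_sum (x # xs) z = (1 + cauchy_sum xs z) + a / (z - \<zeta>)"
      by (simp add: x cauchy_sum_def)
    also have "\<dots> = poly V z / poly W z + a / (z - \<zeta>)" using VW z by simp
    also have "\<dots> = poly (V * L + smult a W) z / poly (W * L) z"
      using VW(4)[OF z(2)] z by (simp add: L_def field_simps)
    finally show ?thesis using VW(4)[OF z(2)] z by (simp add: L_def)
  qed
  ultimately show ?case using deg nz by blast
qed

text \<open>The fraction obtained by clearing denominators need not be in lowest terms, for instance if a pole
  is listed twice with cancelling residues or coincides with \<open>c\<close>. Dividing by the greatest common
  divisor leaves the values off the listed poles and the sign of the difference of degrees unchanged;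
  the latter makes infinity a fixed point.\<close>

lemma exists_rational_map_with_simple_poles:
  fixes c \<alpha> :: complex
  assumes "\<alpha> \<noteq> 0"
  obtains p q where "coprime p q" "q \<noteq> 0" "degree q < degree p"
    "\<And>z. z \<notin> snd ` set xs \<Longrightarrow>
       poly q z \<noteq> 0 \<and> poly p z / poly q z = c + \<alpha> * (z - c) * (1 + cauchy_sum xs z)"
proof -
  obtain V W :: "complex poly" where VW: "V \<noteq> 0" "W \<noteq> 0" "degree V = degree W"
    "\<And>z. z \<notin> snd ` set xs \<Longrightarrow> poly W z \<noteq> 0 \<and> 1 + cauchy_sum xs z = poly V z / poly W z"
    using one_plus_cauchy_sum_as_quotient[of xs] by blast
  define P where "P = [:- c, 1:] * V * [:\<alpha>:] + smult c W"
  have "degree ([:- c, 1:] * V * [:\<alpha>:]) = Suc (degree W)"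
    using VW assms by (simp add: degree_mult_eq del: mult_pCons_left mult_pCons_right)
  then have "degree P = Suc (degree W)"
    unfolding P_def using degree_smult_le[of c W] by (subst degree_add_eq_left) auto
  then have degP: "degree W < degree P" by simp
  have "gcd P W \<noteq> 0" using VW by simp
  then obtain p q where pq: "P = p * gcd P W" "W = q * gcd P W" "coprime p q"
    using gcd_coprime_exists by blast
  define d where "d = gcd P W"
  note pq = pq[folded d_def]
  have nz: "p \<noteq> 0" "q \<noteq> 0" "d \<noteq> 0" using pq VW degP by auto
  have "degree q < degree p" using degP pq nz by (metis add_less_cancel_right degree_mult_eq)
  moreover have "poly q z \<noteq> 0 \<and> poly p z / poly q z = c + \<alpha> * (z - c) * (1 + cauchy_sum xs z)"
    if "z \<notin> snd ` set xs" for z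
  proof -
    have W: "poly W z \<noteq> 0" and s: "1 + cauchy_sum xs z = poly V z / poly W z" using VW that by auto
    have Wz: "poly W z = poly q z * poly d z" and Pz: "poly P z = poly p z * poly d z"
      using pq by (metis poly_mult)+
    have "poly p z / poly q z = poly P z / poly W z" using W Wz Pz by simp
    also have "\<dots> = c + \<alpha> * (z - c) * (poly V z / poly W z)"
      using W by (simp add: P_def field_simps)
    finally show ?thesis using W Wz s by simp
  qed
  ultimately show ?thesis using that pq nz by blast
qed

lemma cauchy_sum_vanishes_at_infinity:
  "((\<lambda>w. cauchy_sum xs (inverse w)) \<longlongrightarrow> 0) (at 0)"
proof (induction xs)
  case (Cons x xs)
  obtain a \<zeta> where x: "x = (a, \<zeta>)" by force
  have "filterlim (\<lambda>w::complex. - \<zeta> + inverse w) at_infinity (at 0)"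
    by (rule tendsto_add_filterlim_at_infinity[OF tendsto_const filterlim_inverse_at_infinity])
  then have "((\<lambda>w. a / (inverse w - \<zeta>)) \<longlongrightarrow> 0) (at 0)"
    by (intro tendsto_divide_0[OF tendsto_const]) simp
  from tendsto_add[OF this Cons] show ?case by (simp add: x cauchy_sum_def)
qed (simp add: cauchy_sum_def)

text \<open>The quotient of the value at \<open>z\<close> by \<open>z\<close> tends to \<open>\<alpha>\<close> at infinity, so that the multiplier there is \<open>1 / \<alpha>\<close>.\<close>

lemma attracting_fixed_point_at_infinity_simple_poles:
  fixes c \<alpha> :: complex
  assumes \<alpha>: "norm \<alpha> > 1" and deg: "degree q < degree p"
    and pq: "\<And>z. z \<notin> snd ` set xs \<Longrightarrow>
       poly q z \<noteq> 0 \<and> poly p z / poly q z = c + \<alpha> * (z - c) * (1 + cauchy_sum xs z)"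
  shows "attracting_fixed_point_at_infinity (rational_map_of p q)"
proof -
  let ?f = "rational_map_of p q"
  define F where "F z = c + \<alpha> * (z - c) * (1 + cauchy_sum xs z)" for z
  define g where "g w = the (sphere_inversion (?f (sphere_inversion (Some w))))" for w
  have "coeff q (max (degree p) (degree q)) = 0"
    using deg by (intro coeff_eq_0) auto
  then have fN: "?f None = None" by (simp add: rational_map_of_def Let_def)
  have fF: "?f (Some z) = Some (F z)" if "z \<notin> snd ` set xs" for z
    using pq[OF that] by (simp add: rational_map_of_def F_def)
  have g0: "g 0 = 0" by (simp add: g_def sphere_inversion_def fN)
  have "((\<lambda>w. c * w + \<alpha> * (1 - c * w) * (1 + cauchy_sum xs (inverse w))) \<longlongrightarrow>
      c * 0 + \<alpha> * (1 - c * 0) * (1 + 0)) (at 0)"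
    by (intro tendsto_intros cauchy_sum_vanishes_at_infinity)
  then have lim: "((\<lambda>w. c * w + \<alpha> * (1 - c * w) * (1 + cauchy_sum xs (inverse w))) \<longlongrightarrow> \<alpha>) (at 0)"
    by simp
  have "\<forall>\<^sub>F w in at 0. w * F (inverse w) = c * w + \<alpha> * (1 - c * w) * (1 + cauchy_sum xs (inverse w))"
    using eventually_neq_at_within[of 0 0 UNIV]
    by eventually_elim (simp add: F_def field_simps)
  then have limF: "((\<lambda>w. w * F (inverse w)) \<longlongrightarrow> \<alpha>) (at 0)"
    using lim by (simp add: tendsto_cong)
  have \<alpha>0: "\<alpha> \<noteq> 0" using \<alpha> by auto
  have "bounded (snd ` set xs)" by (simp add: finite_imp_bounded)
  then obtain b where b: "\<And>z. z \<in> snd ` set xs \<Longrightarrow> norm z \<le> b" by (auto simp: bounded_iff)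
  have "\<forall>\<^sub>F w in at 0. norm (inverse w :: complex) \<ge> b + 1"
    using filterlim_inverse_at_infinity[where 'a = complex] unfolding filterlim_at_infinity_conv_norm_at_top filterlim_at_top
    by blast
  then have ev1: "\<forall>\<^sub>F w in at 0. inverse w \<notin> snd ` set xs"
    by eventually_elim (use b in force)
  have ev2: "\<forall>\<^sub>F w in at 0. w * F (inverse w) \<noteq> 0"
    using tendsto_imp_eventually_ne[OF limF \<alpha>0] .
  have "\<forall>\<^sub>F w in at 0. inverse (w * F (inverse w)) = (g (0 + w) - g 0) / w"
    using ev1 ev2
  proof eventually_elim
    case (elim w)
    then have "w \<noteq> 0" "F (inverse w) \<noteq> 0" by auto
    then show ?case
      using fF[OF elim(1)] by (simp add: g0) (simp add: g_def sphere_inversion_def inverse_eq_divide)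
  qed
  moreover have "((\<lambda>w. inverse (w * F (inverse w))) \<longlongrightarrow> inverse \<alpha>) (at 0)"
    using limF \<alpha>0 by (rule tendsto_inverse)
  ultimately have "((\<lambda>w. (g (0 + w) - g 0) / w) \<longlongrightarrow> inverse \<alpha>) (at 0)"
    by (rule Lim_transform_eventually[rotated])
  then have "(g has_field_derivative inverse \<alpha>) (at 0)"
    by (simp add: DERIV_def)
  moreover have "norm (inverse \<alpha>) < 1"
    using \<alpha> by (simp add: norm_inverse inverse_less_1_iff)
  ultimately show ?thesis
    unfolding attracting_fixed_point_at_infinity_def g_def using fN by blast
qed

section \<open>Trapped and escaping orbits\<close>

text \<open>The factor \<open>h\<close> works as a switch. Where it is nearly \<open>0\<close>, the map sends everything into a tiny
  ball about \<open>c\<close>, on which it is again nearly \<open>0\<close>, so that no orbit leaves. Where it is nearly \<open>1\<close>,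
  the factor \<open>\<alpha>\<close> throws the point out of the ball of radius \<open>R\<close>, into a region where \<open>h\<close> is still
  nearly \<open>1\<close>; since moreover \<open>\<alpha> \<ge> 4\<close>, the distance to \<open>c\<close> keeps doubling.\<close>

lemma switch_map_dynamics:
  fixes c :: complex and \<alpha> \<rho> R :: real
  assumes f: "\<And>z. z \<in> A \<union> B \<Longrightarrow> f (Some z) = Some (c + of_real \<alpha> * (z - c) * h z)"
    and \<rho>: "\<rho> > 0" and A: "cball c \<rho> \<subseteq> A" "A \<subseteq> cball c R"
    and B: "\<And>z. R \<le> norm (z - c) \<Longrightarrow> z \<in> B" and AB: "A \<inter> B = {}"
    and \<alpha>: "\<alpha> \<ge> 4" "\<alpha> * \<rho> \<ge> 2 * R"
    and hA: "\<And>z. z \<in> A \<Longrightarrow> norm (h z) \<le> \<rho> / (\<alpha> * R)"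
    and hB: "\<And>z. z \<in> B \<Longrightarrow> norm (h z - 1) \<le> 1 / 2"
  shows "Some ` A \<subseteq> filled_julia f" "Some ` B \<subseteq> basin_infinity f"
proof -
  define F where "F z = c + of_real \<alpha> * (z - c) * h z" for z
  have nF: "norm (F z - c) = \<alpha> * norm (z - c) * norm (h z)" for z
    using \<alpha> by (simp add: F_def norm_mult)
  have orbit: "(f ^^ n) (Some z) = Some ((F ^^ n) z) \<and> (F ^^ n) z \<in> S"
    if "S \<subseteq> A \<union> B" "\<And>z. z \<in> S \<Longrightarrow> F z \<in> S" "z \<in> S" for n z S
    using that by (induction n) (auto simp: F_def[symmetric] f)
  have R: "R > 0"
  proof -
    have d: "dist c (c + of_real \<rho>) = \<rho>" using \<rho> by (simp add: dist_norm)
    then have "c + of_real \<rho> \<in> cball c R" using A by (metis mem_cball order_refl subsetD)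
    then show ?thesis using d \<rho> by (metis mem_cball less_le_trans)
  qed
  have FA: "F z \<in> A" if z: "z \<in> A" for z
  proof -
    have "norm (F z - c) \<le> \<alpha> * R * (\<rho> / (\<alpha> * R))"
      unfolding nF using z A hA[OF z] \<alpha> R
      by (intro mult_mono) (auto simp: dist_norm norm_minus_commute)
    also have "\<dots> = \<rho>" using \<alpha> R by simp
    finally have "F z \<in> cball c \<rho>" by (simp add: dist_norm norm_minus_commute)
    then show ?thesis using A by blast
  qed
  have FB: "F z \<in> B \<and> norm (F z - c) \<ge> 2 * norm (z - c)" if z: "z \<in> B" for z
  proof -
    have "z \<notin> cball c \<rho>" using z A AB by auto
    then have gt: "norm (z - c) > \<rho>" by (simp add: dist_norm norm_minus_commute)
    have "norm (h z) \<ge> 1 / 2"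
      using hB[OF z] norm_triangle_ineq2[of 1 "1 - h z"] by (simp add: norm_minus_commute)
    then have ge: "norm (F z - c) \<ge> \<alpha> * norm (z - c) * (1 / 2)"
      unfolding nF using \<alpha> by (intro mult_left_mono) auto
    moreover have "\<alpha> * norm (z - c) \<ge> 4 * norm (z - c)"
      using \<alpha> by (intro mult_right_mono) auto
    moreover have "\<alpha> * norm (z - c) \<ge> \<alpha> * \<rho>"
      using \<alpha> gt by (intro mult_left_mono) auto
    ultimately have "R \<le> norm (F z - c)" "2 * norm (z - c) \<le> norm (F z - c)"
      using \<alpha> by linarith+
    then show ?thesis using B by blast
  qed
  show "Some ` A \<subseteq> filled_julia f"
  proof clarify
    fix z assume z: "z \<in> A"
    have "\<not> limitin riemann_sphere (\<lambda>n. (f ^^ n) (Some z)) None sequentially"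
    proof
      assume lim: "limitin riemann_sphere (\<lambda>n. (f ^^ n) (Some z)) None sequentially"
      have op: "openin riemann_sphere (insert None (Some ` (- cball c R)))"
        unfolding openin_Alexandroff_compactification
        by (intro disjI2 exI[of _ "cball c R"]) (auto simp: Compl_eq_Diff_UNIV)
      have "\<forall>\<^sub>F n in sequentially. (f ^^ n) (Some z) \<in> U"
        if "openin riemann_sphere U" "None \<in> U" for U
        using lim that by (simp add: limitin_def)
      from this[OF op] have "\<forall>\<^sub>F n in sequentially. (f ^^ n) (Some z) \<in> insert None (Some ` (- cball c R))" by blast
      then obtain n where "(f ^^ n) (Some z) \<in> insert None (Some ` (- cball c R))"
        using eventually_happens'[OF sequentially_bot] by blast
      moreover have "(f ^^ n) (Some z) = Some ((F ^^ n) z) \<and> (F ^^ n) z \<in> A"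
        using orbit[of A] FA z by blast
      ultimately show False using A by auto
    qed
    then show "Some z \<in> filled_julia f"
      by (simp add: filled_julia_def basin_infinity_def)
  qed
  show "Some ` B \<subseteq> basin_infinity f"
  proof clarify
    fix z assume z: "z \<in> B"
    have far: "norm ((F ^^ n) z - c) \<ge> 2 ^ n * norm (z - c) \<and> (F ^^ n) z \<in> B" for n
    proof (induction n)
      case (Suc n)
      then show ?case using FB[of "(F ^^ n) z"] by auto
    qed (use z in auto)
    have "z \<notin> cball c \<rho>" using z A AB by auto
    then have zc: "norm (z - c) > 0" using \<rho> by auto
    have "\<forall>\<^sub>F n in sequentially. (f ^^ n) (Some z) \<in> U"
      if U: "openin riemann_sphere U" "None \<in> U" for U
    proof -
      obtain K where K: "compact K" "U = insert None (Some ` (- K))"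
        using U by (auto simp: openin_Alexandroff_compactification Compl_eq_Diff_UNIV)
      obtain b where b: "K \<subseteq> ball c b"
        using bounded_subset_ballD[OF compact_imp_bounded[OF K(1)], of c] by blast
      obtain N where N: "b / norm (z - c) < 2 ^ N" using real_arch_pow[of 2] by auto
      have "(f ^^ n) (Some z) \<in> U" if n: "n \<ge> N" for n
      proof -
        have "b < 2 ^ N * norm (z - c)" using N zc by (simp add: field_simps)
        also have "\<dots> \<le> 2 ^ n * norm (z - c)" using n by (intro mult_right_mono power_increasing) auto
        also have "\<dots> \<le> norm ((F ^^ n) z - c)" using far by blast
        finally have "(F ^^ n) z \<notin> K" using b by (auto simp: dist_norm norm_minus_commute)
        moreover have "(f ^^ n) (Some z) = Some ((F ^^ n) z)"
          using orbit[of B] FB z by blast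
        ultimately show ?thesis using K by auto
      qed
      then show ?thesis by (auto simp: eventually_sequentially)
    qed
    then show "Some z \<in> basin_infinity f"
      by (auto simp: basin_infinity_def limitin_def)
  qed
qed

section \<open>Planar sets inside the Riemann sphere\<close>

text \<open>Boundedness keeps infinity out of the closure.\<close>

lemma frontier_of_riemann_sphere_Some:
  assumes "bounded K"
  shows "riemann_sphere frontier_of (Some ` K) = Some ` frontier K"
proof -
  have "riemann_sphere closure_of (Some ` K) = Some ` closure K"
  proof
    have "compact (closure K)" using assms by (simp add: compact_closure)
    then show "riemann_sphere closure_of (Some ` K) \<subseteq> Some ` closure K"
      by (intro closure_of_minimal) (auto intro: closure_subset[THEN subsetD])
    show "Some ` closure K \<subseteq> riemann_sphere closure_of (Some ` K)"
      using continuous_map_image_closure_subset[OF continuous_map_Some[of "euclidean :: complex topology"], of K]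
      by simp
  qed
  moreover have "riemann_sphere interior_of (Some ` K) = Some ` interior K"
  proof
    show "Some ` interior K \<subseteq> riemann_sphere interior_of (Some ` K)"
      by (rule interior_of_maximal) (auto intro: interior_subset[THEN subsetD])
    have "openin riemann_sphere (riemann_sphere interior_of (Some ` K))" by simp
    moreover have sub: "riemann_sphere interior_of (Some ` K) \<subseteq> Some ` K" by (rule interior_of_subset)
    ultimately obtain U where U: "open U" "riemann_sphere interior_of (Some ` K) = Some ` U"
      unfolding openin_Alexandroff_compactification by auto
    then have "U \<subseteq> interior K" using sub by (intro interior_maximal) auto
    then show "riemann_sphere interior_of (Some ` K) \<subseteq> Some ` interior K" using U by auto
  qed
  ultimately show ?thesis
    by (simp add: frontier_of_def frontier_def image_set_diff)
qed

text \<open>Off the curve the sphere splits into two disjoint open connected pieces, the inside and the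
  outside together with infinity, and only the first of them is bounded.\<close>

lemma Union_bounded_components_Jordan_curve:
  fixes g :: "real \<Rightarrow> complex"
  assumes "simple_path g" "pathfinish g = pathstart g"
  shows "\<Union> (bounded_components (Some ` path_image g)) = Some ` inside (path_image g)"
proof -
  define C where "C = path_image g"
  define I where "I = inside C"
  define E where "E = outside C"
  define X where "X = subtopology riemann_sphere (UNIV - Some ` C)"
  have J: "I \<noteq> {}" "open I" "connected I" "E \<noteq> {}" "open E" "connected E" "bounded I" "\<not> bounded E"
    using Jordan_inside_outside[OF assms] by (auto simp: C_def I_def E_def)
  have split: "I \<union> E = - C" "I \<inter> E = {}" "I \<inter> C = {}" "E \<inter> C = {}"
    unfolding I_def E_def
    using inside_Un_outside[of C] inside_Int_outside[of C] inside_no_overlap[of C] outside_no_overlap[of C]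
    by auto
  have bC: "bounded C"
    unfolding C_def using assms by (simp add: bounded_simple_path_image)
  have oI: "openin X (Some ` I)"
    unfolding X_def openin_subtopology using J split by (intro exI[of _ "Some ` I"]) auto
  have "- E = I \<union> C" using split by auto
  then have "bounded (- E)" using J bC by simp
  then have "compact (- E)" using J by (simp add: compact_eq_bounded_closed closed_Compl)
  moreover have "insert None (Some ` E) = insert None (Some ` (topspace euclidean - (- E)))" by auto
  ultimately have "openin riemann_sphere (insert None (Some ` E))"
    unfolding openin_Alexandroff_compactification
    by (metis (no_types, lifting) closed_closedin compact_imp_closed compactin_euclidean_iff)
  then have oE: "openin X (insert None (Some ` E))"
    unfolding X_def openin_subtopology using split by (intro exI[of _ "insert None (Some ` E)"]) auto
  have conn: "connectedin X (Some ` S)" if "connected S" "S \<inter> C = {}" for S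
    unfolding X_def connectedin_subtopology using that
    by (auto intro!: connectedin_continuous_map_image[OF continuous_map_Some])
  have tX: "topspace X = Some ` I \<union> insert None (Some ` E)"
  proof -
    have "w \<in> topspace X \<longleftrightarrow> w \<in> Some ` I \<union> insert None (Some ` E)" for w
      using split by (cases w) (auto simp: X_def)
    then show ?thesis by blast
  qed
  have one_side: "D \<inter> Some ` I = {} \<or> D \<inter> insert None (Some ` E) = {}"
    if D: "D \<in> connected_components_of X" for D
  proof -
    have "connectedin X D" using D by (rule connectedin_connected_components_of)
    moreover have "D \<subseteq> Some ` I \<union> insert None (Some ` E)"
      using connected_components_of_subset[OF D] tX by simp
    moreover have "Some ` I \<inter> insert None (Some ` E) \<inter> D = {}" using split by auto
    ultimately show ?thesis using oI oE unfolding connectedin by blast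
  qed
  have "Some ` I \<subseteq> \<Union> (bounded_components (Some ` C))"
  proof -
    have "X \<noteq> trivial_topology" using tX by force
    then obtain D where D: "D \<in> connected_components_of X" "Some ` I \<subseteq> D"
      using exists_connected_component_of_superset[OF conn[OF J(3) split(3)]] by blast
    then have "D \<inter> insert None (Some ` E) = {}" using one_side[OF D(1)] J by auto
    then have "D = Some ` I" using D connected_components_of_subset[OF D(1)] tX by auto
    then show ?thesis using D J unfolding bounded_components_def X_def by auto
  qed
  moreover have "D \<subseteq> Some ` I" if D: "D \<in> bounded_components (Some ` C)" for D
  proof (rule ccontr)
    assume no: "\<not> D \<subseteq> Some ` I"
    obtain B where B: "bounded B" "D = Some ` B" and comp: "D \<in> connected_components_of X"
      using D unfolding bounded_components_def X_def by auto
    have "D \<subseteq> insert None (Some ` E)"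
      using no one_side[OF comp] connected_components_of_subset[OF comp] tX by auto
    moreover have "D \<noteq> {}" using comp by (rule nonempty_connected_components_of)
    ultimately have "\<not> disjnt D (Some ` E)" using B by (auto simp: disjnt_def)
    then have "Some ` E \<subseteq> D"
      using connected_components_of_maximal[OF comp conn[OF J(6) split(4)]] by blast
    then have "E \<subseteq> B" using B by auto
    then show False using B J bounded_subset by blast
  qed
  ultimately show ?thesis unfolding C_def I_def by blast
qed

section \<open>Hausdorff distances\<close>

lemma hausdorff_dist_le:
  assumes "e > 0" "X \<subseteq> closed_nbhd e Y" "Y \<subseteq> closed_nbhd e X"
  shows "hausdorff_dist X Y \<le> ennreal e"
  unfolding hausdorff_dist_def using assms by (intro Inf_lower) blast

lemma sphere_hausdorff_dist_Some:
  "sphere_hausdorff_dist (Some ` X) (Some ` Y) = hausdorff_dist X Y"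
  by (simp add: sphere_hausdorff_dist_def inj_vimage_image_eq)

text \<open>Cutting off a neighbourhood of infinity that both sets contain preserves the two inclusions, provided
  that the radius is large; the value at a single such radius is the distance.\<close>

lemma sphere_hausdorff_dist_infinity_le:
  assumes e: "e > 0" and XY: "X \<subseteq> closed_nbhd e Y" "Y \<subseteq> closed_nbhd e X"
    and far: "{z. norm z > r} \<subseteq> X" "{z. norm z > r} \<subseteq> Y"
  shows "sphere_hausdorff_dist (insert None (Some ` X)) (insert None (Some ` Y)) \<le> ennreal e"
proof -
  let ?X = "insert None (Some ` X)" and ?Y = "insert None (Some ` Y)" and ?r = "max r 0"
  have v: "Some -` ?X = X" "Some -` ?Y = Y" by auto
  have "\<forall>\<^sub>F R in at_top. hausdorff_dist (X - {z. norm z > R}) (Y - {z. norm z > R})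
      = sphere_hausdorff_dist ?X ?Y"
    using sphere_hausdorff_dist_eventually[of ?X ?Y r] far unfolding v by auto
  moreover have "\<forall>\<^sub>F R in at_top. R \<ge> 3 * ?r + 1" by (rule eventually_ge_at_top)
  ultimately have "\<forall>\<^sub>F R :: real in at_top. sphere_hausdorff_dist ?X ?Y \<le> ennreal e"
  proof eventually_elim
    case (elim R)
    have X: "{z. norm z > ?r} \<subseteq> X" and Y: "{z. norm z > ?r} \<subseteq> Y" using far by auto
    have "hausdorff_dist (X - {z. norm z > R}) (Y - {z. norm z > R}) \<le> ennreal e"
      using truncated_subset_closed_nbhd_iff[OF _ X Y elim(2) e]
        truncated_subset_closed_nbhd_iff[OF _ Y X elim(2) e] XY e
      by (intro hausdorff_dist_le) auto
    then show ?case using elim(1) by simp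
  qed
  then show ?thesis by simp
qed

text \<open>Each point of \<open>C\<close> has some point of \<open>S\<close> nearby, which has a positive distance from \<open>C\<close>. Finitely
  many of these points of \<open>S\<close> serve all of the compact set \<open>C\<close>, so that the least of their distances
  serves as \<open>\<epsilon>\<close>.\<close>

lemma uniform_depth_near_boundary:
  fixes C S :: "complex set"
  assumes C: "compact C" "C \<noteq> {}" and S: "C \<subseteq> closure S" "S \<inter> C = {}" and r: "r > 0"
  shows "\<exists>\<epsilon>>0. \<forall>x\<in>C. \<exists>y\<in>S. dist x y \<le> r \<and> \<epsilon> \<le> infdist y C"
proof -
  have "\<exists>y\<in>S. dist y x < r / 2" if "x \<in> C" for x
    using S that r by (metis closure_approachable half_gt_zero subsetD)
  then obtain y where y: "\<And>x. x \<in> C \<Longrightarrow> y x \<in> S" "\<And>x. x \<in> C \<Longrightarrow> dist (y x) x < r / 2"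
    by metis
  have "C \<subseteq> (\<Union>x\<in>C. ball x (r / 2))" using r by auto
  then obtain D where D: "D \<subseteq> C" "finite D" "C \<subseteq> (\<Union>x\<in>D. ball x (r / 2))"
    using compactE_image[OF C(1), of C "\<lambda>x. ball x (r / 2)"] by auto
  have "D \<noteq> {}" using D C by auto
  define \<epsilon> where "\<epsilon> = Min ((\<lambda>x. infdist (y x) C) ` D)"
  have pos: "infdist (y x) C > 0" if "x \<in> D" for x
    using y(1)[of x] that D S C by (intro infdist_pos_not_in_closed compact_imp_closed) auto
  have "\<epsilon> > 0" unfolding \<epsilon>_def using D \<open>D \<noteq> {}\<close> pos by simp
  moreover have "\<exists>y\<in>S. dist x y \<le> r \<and> \<epsilon> \<le> infdist y C" if x: "x \<in> C" for x
  proof -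
    obtain w where w: "w \<in> D" "dist w x < r / 2" using D x by auto
    have "dist x (y w) \<le> r"
      using w y(2)[of w] D dist_triangle[of x "y w" w] by (auto simp: dist_commute)
    moreover have "\<epsilon> \<le> infdist (y w) C" unfolding \<epsilon>_def using D w by simp
    ultimately show ?thesis using y(1) w D by blast
  qed
  ultimately show ?thesis by blast
qed

text \<open>Call a point deep if its distance from \<open>C\<close> is at least \<open>\<epsilon>\<close>. The sets \<open>S\<close> and \<open>K\<close> differ only at points closer than \<open>\<epsilon>\<close> to \<open>C\<close>, and each such point has a deep point of
  \<open>S\<close>, which belongs to both sets, within \<open>\<epsilon> + r\<close>. The lemma serves for the filled Julia set (with \<open>S\<close>
  the interiors) as well as for the basin (with \<open>S\<close> the exteriors).\<close>

lemma closed_nbhd_of_set_separating_deep_points: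
  fixes C S T K :: "complex set"
  assumes C: "compact C" "C \<noteq> {}" and cover: "S \<union> C \<union> T = UNIV"
    and \<epsilon>: "0 < \<epsilon>" "\<epsilon> \<le> r"
    and depth: "\<And>x. x \<in> C \<Longrightarrow> \<exists>y\<in>S. dist x y \<le> r \<and> \<epsilon> \<le> infdist y C"
    and K: "{x \<in> S. \<epsilon> \<le> infdist x C} \<subseteq> K" "K \<inter> {x \<in> T. \<epsilon> \<le> infdist x C} = {}"
  shows "S \<subseteq> closed_nbhd (2 * r) K" "K \<subseteq> closed_nbhd (2 * r) S"
proof -
  have near: "\<exists>y\<in>S. dist y x \<le> 2 * r \<and> \<epsilon> \<le> infdist y C" if "infdist x C < \<epsilon>" for x
  proof -
    obtain c where c: "c \<in> C" "infdist x C = dist x c"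
      using infdist_attains_inf[OF compact_imp_closed[OF C(1)] C(2)] by blast
    obtain y where y: "y \<in> S" "dist c y \<le> r" "\<epsilon> \<le> infdist y C" using depth[OF c(1)] by blast
    have "dist y x \<le> 2 * r"
      using dist_triangle[of y x c] c y that \<epsilon> by (simp add: dist_commute)
    then show ?thesis using y by blast
  qed
  show "S \<subseteq> closed_nbhd (2 * r) K"
  proof
    fix x assume x: "x \<in> S"
    show "x \<in> closed_nbhd (2 * r) K"
    proof (cases "infdist x C < \<epsilon>")
      case True
      then show ?thesis using near[OF True] K(1) by (auto simp: closed_nbhd_def)
    next
      case False
      then have "x \<in> K" using x K(1) by auto
      then show ?thesis using \<epsilon> by (force simp: closed_nbhd_def)
    qed
  qed
  show "K \<subseteq> closed_nbhd (2 * r) S"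
  proof
    fix x assume x: "x \<in> K"
    show "x \<in> closed_nbhd (2 * r) S"
    proof (cases "infdist x C < \<epsilon>")
      case True
      then show ?thesis using near[OF True] by (auto simp: closed_nbhd_def)
    next
      case False
      then have "x \<notin> C" "x \<notin> T" using x K(2) \<epsilon> by auto
      then have "x \<in> S" using cover by auto
      then show ?thesis using \<epsilon> by (force simp: closed_nbhd_def)
    qed
  qed
qed

text \<open>A ball that contains points of both \<open>K\<close> and its complement meets the frontier of \<open>K\<close>; conversely,
  a point farther than \<open>\<epsilon>\<close> from \<open>C\<close> has a neighbourhood of deep points of \<open>S\<close>, all in \<open>K\<close>, or of deep points of
  \<open>T\<close>, all outside \<open>K\<close>, so that it is not in the frontier.\<close>

lemma closed_nbhd_of_frontier_separating_deep_points:
  fixes C S T K :: "complex set"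
  assumes C: "compact C" "C \<noteq> {}" and cover: "S \<union> C \<union> T = UNIV" and ST: "open S" "open T"
    and \<epsilon>: "0 < \<epsilon>" "\<epsilon> \<le> r"
    and depthS: "\<And>x. x \<in> C \<Longrightarrow> \<exists>y\<in>S. dist x y \<le> r \<and> \<epsilon> \<le> infdist y C"
    and depthT: "\<And>x. x \<in> C \<Longrightarrow> \<exists>y\<in>T. dist x y \<le> r \<and> \<epsilon> \<le> infdist y C"
    and K: "{x \<in> S. \<epsilon> \<le> infdist x C} \<subseteq> K" "K \<inter> {x \<in> T. \<epsilon> \<le> infdist x C} = {}"
  shows "C \<subseteq> closed_nbhd (2 * r) (frontier K)" "frontier K \<subseteq> closed_nbhd (2 * r) C"
proof -
  show "C \<subseteq> closed_nbhd (2 * r) (frontier K)"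
  proof
    fix x assume x: "x \<in> C"
    obtain y where y: "y \<in> S" "dist x y \<le> r" "\<epsilon> \<le> infdist y C" using depthS[OF x] by blast
    obtain y' where y': "y' \<in> T" "dist x y' \<le> r" "\<epsilon> \<le> infdist y' C" using depthT[OF x] by blast
    have "cball x r \<inter> K \<noteq> {}" "cball x r - K \<noteq> {}" using y y' K by auto
    then have "cball x r \<inter> frontier K \<noteq> {}"
      using connected_Int_frontier[OF connected_cball] by blast
    then show "x \<in> closed_nbhd (2 * r) (frontier K)"
      using \<epsilon> by (force simp: closed_nbhd_def dist_commute)
  qed
  show "frontier K \<subseteq> closed_nbhd (2 * r) C"
  proof
    fix x assume x: "x \<in> frontier K"
    have "infdist x C \<le> \<epsilon>"
    proof (rule ccontr)
      assume "\<not> infdist x C \<le> \<epsilon>"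
      then have gt: "\<epsilon> < infdist x C" by simp
      have op: "open {z. \<epsilon> < infdist z C}"
        by (intro open_Collect_less continuous_intros)
      have "x \<notin> C" using gt \<epsilon> by auto
      then have "x \<in> S \<or> x \<in> T" using cover by auto
      then show False
      proof
        assume "x \<in> S"
        have "S \<inter> {z. \<epsilon> < infdist z C} \<subseteq> interior K"
          using K(1) ST op by (intro interior_maximal) auto
        then show False using x gt \<open>x \<in> S\<close> by (auto simp: frontier_def)
      next
        assume "x \<in> T"
        have "T \<inter> {z. \<epsilon> < infdist z C} \<subseteq> interior (- K)"
          using K(2) ST op by (intro interior_maximal) auto
        then show False using x gt \<open>x \<in> T\<close> by (auto simp: frontier_def interior_complement)
      qed
    qed
    moreover obtain c where "c \<in> C" "infdist x C = dist x c"
      using infdist_attains_inf[OF compact_imp_closed[OF C(1)] C(2)] by blast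
    ultimately show "x \<in> closed_nbhd (2 * r) C"
      using \<epsilon> by (force simp: closed_nbhd_def dist_commute)
  qed
qed

section \<open>Mutually exterior Jordan curves\<close>

text \<open>The winding number is \<open>1\<close> or \<open>-1\<close> inside, according to the orientation, and \<open>0\<close> outside.\<close>

lemma cauchy_approximable_indicator_inside:
  fixes g :: "real \<Rightarrow> complex"
  assumes g: "simple_path g" "pathfinish g = pathstart g" and \<epsilon>: "\<epsilon> > 0"
  shows "cauchy_approximable {\<zeta>. infdist \<zeta> (path_image g) < \<epsilon>}
    {z. \<epsilon> \<le> infdist z (path_image g)} (\<lambda>z. of_bool (z \<in> inside (path_image g)))"
proof -
  let ?C = "path_image g"
  have p: "path g" using g by (simp add: simple_path_imp_path)
  note appr = cauchy_approximable_winding_number[OF p g(2) \<epsilon>]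
  have side: "z \<in> inside ?C \<or> winding_number g z = 0 \<and> z \<notin> inside ?C"
    if "z \<in> {z. \<epsilon> \<le> infdist z ?C}" for z
  proof -
    have "z \<notin> ?C" using that \<epsilon> by auto
    then show ?thesis
      using inside_Un_outside[of ?C] winding_number_zero_in_outside[OF p g(2)] by blast
  qed
  from g(1) show ?thesis
  proof (cases rule: simple_closed_path_winding_number_inside)
    case 1
    then show ?thesis
      using side by (intro cauchy_approximable_mono[OF appr]) auto
  next
    case 2
    then show ?thesis
      using side by (intro cauchy_approximable_mono[OF cauchy_approximable_minus[OF appr]]) fastforce+
  qed
qed

text \<open>The closed disc bounded by the first curve is connected and misses the second curve. If it met
  the inside of the second curve, it would therefore lie there, but its boundary does not.\<close>

lemma inside_subset_outside_of_exterior_Jordan_curve: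
  fixes g h :: "real \<Rightarrow> complex"
  assumes g: "simple_path g" "pathfinish g = pathstart g"
    and h: "simple_path h" "pathfinish h = pathstart h"
    and ext: "path_image g \<subseteq> outside (path_image h)" "path_image h \<subseteq> outside (path_image g)"
  shows "inside (path_image g) \<subseteq> outside (path_image h)"
proof -
  let ?G = "path_image g" and ?H = "path_image h"
  note Jg = Jordan_inside_outside[OF g] and Jh = Jordan_inside_outside[OF h]
  define D where "D = closure (inside ?G)"
  have D: "connected D" "D = inside ?G \<union> ?G"
    using Jg connected_imp_connected_closure[of "inside ?G"] by (simp_all add: D_def closure_Un_frontier)
  have "D \<inter> ?H = {}"
    using ext D inside_Int_outside[of ?G] outside_no_overlap[of ?G] by blast
  then have "D \<inter> frontier (inside ?H) = {}" using Jh by simp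
  moreover have "D - inside ?H \<noteq> {}"
    using D ext(1) inside_Int_outside[of ?H] by (metis Diff_eq_empty_iff Un_subset_iff disjoint_iff
        path_image_nonempty ex_in_conv subsetD)
  ultimately have "D \<inter> inside ?H = {}"
    using connected_Int_frontier[OF D(1)] by blast
  then show ?thesis
    using \<open>D \<inter> ?H = {}\<close> D inside_Un_outside[of ?H] by blast
qed

locale exterior_Jordan_curves =
  fixes N :: "'i set" and \<gamma> :: "'i \<Rightarrow> real \<Rightarrow> complex"
  assumes fin: "finite N" and nonempty: "N \<noteq> {}"
    and simple: "i \<in> N \<Longrightarrow> simple_path (\<gamma> i)"
    and closed: "i \<in> N \<Longrightarrow> pathfinish (\<gamma> i) = pathstart (\<gamma> i)"
    and exterior: "i \<in> N \<Longrightarrow> j \<in> N \<Longrightarrow> i \<noteq> j \<Longrightarrow> path_image (\<gamma> j) \<subseteq> outside (path_image (\<gamma> i))"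
begin

definition curves :: "complex set" where "curves = (\<Union>i\<in>N. path_image (\<gamma> i))"
definition interiors :: "complex set" where "interiors = (\<Union>i\<in>N. inside (path_image (\<gamma> i)))"
definition exteriors :: "complex set" where "exteriors = (\<Inter>i\<in>N. outside (path_image (\<gamma> i)))"

lemmas Jordan = Jordan_inside_outside[OF simple closed]

lemma inside_subset_outside:
  assumes "i \<in> N" "j \<in> N" "i \<noteq> j"
  shows "inside (path_image (\<gamma> i)) \<subseteq> outside (path_image (\<gamma> j))"
  using assms simple closed exterior
  by (intro inside_subset_outside_of_exterior_Jordan_curve) auto

lemma cover: "interiors \<union> curves \<union> exteriors = UNIV"
  unfolding interiors_def curves_def exteriors_def using inside_Un_outside by fastforce

lemma interiors_Int_exteriors: "interiors \<inter> exteriors = {}"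
  unfolding interiors_def exteriors_def using inside_Int_outside by blast

lemma curves_Int_exteriors: "exteriors \<inter> curves = {}"
  unfolding curves_def exteriors_def using outside_no_overlap by blast

lemma interiors_Int_curves: "interiors \<inter> curves = {}"
proof -
  have "inside (path_image (\<gamma> i)) \<inter> path_image (\<gamma> j) = {}" if "i \<in> N" "j \<in> N" for i j
    using inside_no_overlap[of "path_image (\<gamma> j)"] exterior[OF that]
      inside_Int_outside[of "path_image (\<gamma> i)"] by (cases "i = j") blast+
  then show ?thesis unfolding interiors_def curves_def by blast
qed

lemma open_interiors: "open interiors"
  unfolding interiors_def using Jordan by (intro open_UN) blast

lemma open_exteriors: "open exteriors"
  unfolding exteriors_def using Jordan fin by (intro open_INT) auto

lemma compact_curves: "compact curves"
  unfolding curves_def using fin simple by (intro compact_UN) (auto intro: compact_simple_path_image)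

lemma curves_nonempty: "curves \<noteq> {}"
  using nonempty by (auto simp: curves_def)

lemma interiors_nonempty: "interiors \<noteq> {}"
  using nonempty Jordan by (auto simp: interiors_def)

lemma bounded_interiors: "bounded interiors"
  unfolding interiors_def using fin Jordan by (intro bounded_UN) auto

lemma curves_subset_closure_interiors: "curves \<subseteq> closure interiors"
proof
  fix x assume "x \<in> curves"
  then obtain i where i: "i \<in> N" "x \<in> path_image (\<gamma> i)" by (auto simp: curves_def)
  then have "x \<in> closure (inside (path_image (\<gamma> i)))"
    using Jordan[OF i(1) i(1)] by (simp add: closure_Un_frontier)
  moreover have "inside (path_image (\<gamma> i)) \<subseteq> interiors" using i by (auto simp: interiors_def)
  ultimately show "x \<in> closure interiors" using closure_mono by blast
qed

text \<open>Near a point of one curve, the other curves have only outside points, so the points outside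
  that one curve are outside all of them.\<close>

lemma curves_subset_closure_exteriors: "curves \<subseteq> closure exteriors"
proof
  fix x assume "x \<in> curves"
  then obtain i where i: "i \<in> N" "x \<in> path_image (\<gamma> i)" by (auto simp: curves_def)
  define U where "U = (\<Inter>j\<in>N - {i}. outside (path_image (\<gamma> j)))"
  have "open U" unfolding U_def using Jordan fin by (intro open_INT) auto
  moreover have "x \<in> U" using exterior i by (auto simp: U_def)
  moreover have "x \<in> closure (outside (path_image (\<gamma> i)))"
    using Jordan[OF i(1) i(1)] i by (simp add: closure_Un_frontier)
  ultimately have "x \<in> closure (U \<inter> outside (path_image (\<gamma> i)))"
    using open_Int_closure_subset by blast
  moreover have "U \<inter> outside (path_image (\<gamma> i)) \<subseteq> exteriors" by (auto simp: U_def exteriors_def)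
  ultimately show "x \<in> closure exteriors" using closure_mono by blast
qed

lemma cauchy_approximable_indicator_interiors:
  assumes \<epsilon>: "\<epsilon> > 0"
  shows "cauchy_approximable {\<zeta>. infdist \<zeta> curves < \<epsilon>} {z. \<epsilon> \<le> infdist z curves}
    (\<lambda>z. of_bool (z \<in> interiors))"
proof -
  have le: "infdist z curves \<le> infdist z (path_image (\<gamma> i))" if "i \<in> N" for i z
    using that by (intro infdist_mono) (auto simp: curves_def)
  have "cauchy_approximable {\<zeta>. infdist \<zeta> curves < \<epsilon>} {z. \<epsilon> \<le> infdist z curves}
      (\<lambda>z. \<Sum>i\<in>N. of_bool (z \<in> inside (path_image (\<gamma> i))))"
  proof (intro cauchy_approximable_sum fin)
    fix i assume i: "i \<in> N"
    show "cauchy_approximable {\<zeta>. infdist \<zeta> curves < \<epsilon>} {z. \<epsilon> \<le> infdist z curves}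
        (\<lambda>z. of_bool (z \<in> inside (path_image (\<gamma> i))))"
      by (rule cauchy_approximable_mono[OF cauchy_approximable_indicator_inside[OF simple[OF i] closed[OF i] \<epsilon>]])
        (use le[OF i] in \<open>auto intro: le_less_trans order_trans\<close>)
  qed
  moreover have "(\<Sum>i\<in>N. of_bool (z \<in> inside (path_image (\<gamma> i)))) = (of_bool (z \<in> interiors) :: complex)" for z
  proof (cases "z \<in> interiors")
    case True
    then obtain i where i: "i \<in> N" "z \<in> inside (path_image (\<gamma> i))" by (auto simp: interiors_def)
    have "z \<notin> inside (path_image (\<gamma> j))" if "j \<in> N - {i}" for j
      using inside_subset_outside[of i j] i that inside_Int_outside[of "path_image (\<gamma> j)"] by blast
    then have "(\<Sum>j\<in>N - {i}. of_bool (z \<in> inside (path_image (\<gamma> j)))) = (0 :: complex)"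
      by (intro sum.neutral) auto
    then show ?thesis using i True by (subst sum.remove[OF fin i(1)]) simp
  next
    case False
    then show ?thesis by (auto simp: interiors_def)
  qed
  ultimately show ?thesis by simp
qed

text \<open>The rational map is \<open>c + \<alpha> (z - c) h z\<close>, where \<open>h\<close> is a rational approximation of
  \<open>1\<close> minus the indicator function of the interiors. As \<open>c\<close> lies inside a curve, the distance of outside
  points from \<open>c\<close> is bounded below, which lets a single large \<open>\<alpha>\<close> expel all of them.\<close>

lemma exists_rational_map_separating_deep_points:
  assumes \<epsilon>0: "\<epsilon>0 > 0"
  obtains \<epsilon> p q R where "0 < \<epsilon>" "\<epsilon> \<le> \<epsilon>0" "q \<noteq> 0" "coprime p q"
    "attracting_fixed_point_at_infinity (rational_map_of p q)"
    "Some ` {z \<in> interiors. \<epsilon> \<le> infdist z curves} \<subseteq> filled_julia (rational_map_of p q)"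
    "Some ` {z \<in> exteriors. \<epsilon> \<le> infdist z curves} \<subseteq> basin_infinity (rational_map_of p q)"
    "{z. norm z > R} \<subseteq> {z \<in> exteriors. \<epsilon> \<le> infdist z curves}"
proof -
  obtain c where c: "c \<in> interiors" using interiors_nonempty by blast
  define d where "d = infdist c curves"
  have "d > 0"
    unfolding d_def using c interiors_Int_curves compact_curves curves_nonempty
    by (intro infdist_pos_not_in_closed compact_imp_closed) auto
  define \<epsilon> where "\<epsilon> = min \<epsilon>0 (d / 2)"
  \<comment> \<open>Half of the distance from \<open>c\<close> to the curves leaves all of \<open>cball c \<rho>\<close> deep.\<close>
  define \<rho> where "\<rho> = d / 2"
  have pos: "\<epsilon> > 0" "\<epsilon> \<le> \<epsilon>0" "\<rho> > 0" "\<epsilon> \<le> \<rho>" using \<open>d > 0\<close> \<epsilon>0 by (auto simp: \<epsilon>_def \<rho>_def)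
  define A where "A = {z \<in> interiors. \<epsilon> \<le> infdist z curves}"
  define B where "B = {z \<in> exteriors. \<epsilon> \<le> infdist z curves}"
  have AB: "A \<inter> B = {}" using interiors_Int_exteriors by (auto simp: A_def B_def)
  have deep: "\<epsilon> \<le> infdist z curves" if "z \<in> cball c \<rho>" for z
  proof -
    have "d \<le> infdist z curves + dist c z" unfolding d_def by (rule infdist_triangle)
    then show ?thesis using that pos by (simp add: \<rho>_def)
  qed
  have "cball c \<rho> \<subseteq> interiors \<union> exteriors"
  proof
    fix z assume "z \<in> cball c \<rho>"
    then have "z \<notin> curves" using deep[of z] pos by auto
    then show "z \<in> interiors \<union> exteriors" using cover by auto
  qed
  moreover have "c \<in> interiors \<inter> cball c \<rho>" using c pos by simp
  ultimately have "exteriors \<inter> cball c \<rho> = {}"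
    using connectedD[OF connected_cball open_interiors open_exteriors, of c \<rho>] interiors_Int_exteriors
    by blast
  then have ballA: "cball c \<rho> \<subseteq> A"
    using deep \<open>cball c \<rho> \<subseteq> interiors \<union> exteriors\<close> by (auto simp: A_def)
  have "bounded (interiors \<union> curves)" using bounded_interiors compact_curves compact_imp_bounded by auto
  then obtain b where b: "interiors \<union> curves \<subseteq> ball c b" using bounded_subset_ballD by blast
  define R where "R = b + \<epsilon>"
  have AR: "A \<subseteq> cball c R" using b pos by (force simp: A_def R_def)
  have farB: "z \<in> B" if z: "R \<le> norm (z - c)" for z
  proof -
    have dz: "R \<le> dist c z" using z by (simp add: dist_norm norm_minus_commute)
    then have "z \<notin> interiors \<union> curves" using b pos by (auto simp: R_def)
    then have "z \<in> exteriors" using cover by blast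
    moreover obtain w where w: "w \<in> curves" "infdist z curves = dist z w"
      using infdist_attains_inf[OF compact_imp_closed[OF compact_curves] curves_nonempty] by blast
    have "dist c w < b" using b w by auto
    then have "\<epsilon> \<le> infdist z curves"
      using dz dist_triangle[of c z w] by (simp add: w R_def dist_commute)
    ultimately show ?thesis by (simp add: B_def)
  qed
  \<comment> \<open>The factor must be fixed before the quality \<open>\<eta>\<close> of the approximation, which depends on it.\<close>
  define \<alpha> where "\<alpha> = max 4 (2 * R / \<rho>)"
  have \<alpha>: "\<alpha> \<ge> 4" "\<alpha> * \<rho> \<ge> 2 * R"
    using pos by (auto simp: \<alpha>_def max_def field_simps)
  have "b > 0" using b c by (metis UnCI ball_eq_empty empty_iff not_le subsetD)
  then have R: "R > 0" using pos by (simp add: R_def)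
  define \<eta> where "\<eta> = min (1 / 2) (\<rho> / (\<alpha> * R))"
  have "\<rho> / (\<alpha> * R) > 0" using \<alpha> R pos by (intro divide_pos_pos mult_pos_pos) auto
  then have \<eta>: "\<eta> > 0" "\<eta> \<le> 1 / 2" "\<eta> \<le> \<rho> / (\<alpha> * R)"
    unfolding \<eta>_def by linarith+
  have "cauchy_approximable {\<zeta>. infdist \<zeta> curves < \<epsilon>} {z. \<epsilon> \<le> infdist z curves}
      (\<lambda>z. - of_bool (z \<in> interiors))"
    by (intro cauchy_approximable_minus cauchy_approximable_indicator_interiors pos)
  from this[unfolded cauchy_approximable_def, THEN spec, THEN mp, OF \<eta>(1)]
  obtain xs where xs1: "snd ` set xs \<subseteq> {\<zeta>. infdist \<zeta> curves < \<epsilon>}"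
    and "\<forall>z\<in>{z. \<epsilon> \<le> infdist z curves}. norm (cauchy_sum xs z - - of_bool (z \<in> interiors)) \<le> \<eta>"
    by (elim exE conjE)
  then have xs2: "norm (cauchy_sum xs z - - of_bool (z \<in> interiors)) \<le> \<eta>"
    if "\<epsilon> \<le> infdist z curves" for z
    using that by simp
  have "complex_of_real \<alpha> \<noteq> 0" using \<alpha> by auto
  then obtain p q where pq: "coprime p q" "q \<noteq> 0" "degree q < degree p"
    "\<And>z. z \<notin> snd ` set xs \<Longrightarrow>
       poly q z \<noteq> 0 \<and> poly p z / poly q z = c + of_real \<alpha> * (z - c) * (1 + cauchy_sum xs z)"
    using exists_rational_map_with_simple_poles by blast
  let ?f = "rational_map_of p q"
  have attr: "attracting_fixed_point_at_infinity ?f"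
    by (rule attracting_fixed_point_at_infinity_simple_poles[OF _ pq(3,4)]) (use \<alpha> in auto)
  have f: "?f (Some z) = Some (c + of_real \<alpha> * (z - c) * (1 + cauchy_sum xs z))"
    if "z \<in> A \<union> B" for z
  proof -
    have "z \<notin> snd ` set xs" using that xs1 by (force simp: A_def B_def)
    from pq(4)[OF this] show ?thesis by (simp add: rational_map_of_def)
  qed
  have hA: "norm (1 + cauchy_sum xs z) \<le> \<rho> / (\<alpha> * R)" if "z \<in> A" for z
    using xs2[of z] that \<eta>(3) by (auto simp: A_def add.commute)
  have hB: "norm (1 + cauchy_sum xs z - 1) \<le> 1 / 2" if "z \<in> B" for z
  proof -
    have "z \<notin> interiors" using that interiors_Int_exteriors by (auto simp: B_def)
    then show ?thesis using xs2[of z] that \<eta>(2) by (simp add: B_def)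
  qed
  have dyn: "Some ` A \<subseteq> filled_julia ?f" "Some ` B \<subseteq> basin_infinity ?f"
    using switch_map_dynamics[where f = ?f and h = "\<lambda>z. 1 + cauchy_sum xs z",
        OF f pos(3) ballA AR farB AB \<alpha> hA hB] by simp_all
  have far: "{z. norm z > R + norm c} \<subseteq> B"
  proof
    fix z :: complex assume "z \<in> {z. norm z > R + norm c}"
    then have "R \<le> norm (z - c)" using norm_triangle_ineq2[of z c] by simp
    then show "z \<in> B" by (rule farB)
  qed
  show ?thesis
    by (rule that[OF pos(1,2) pq(2,1) attr dyn[unfolded A_def B_def] far[unfolded B_def]])
qed

end

section \<open>Approximation of Jordan curves by Julia sets\<close>

theorem theorem3p3:
  fixes \<J> :: "csphere set set" and \<delta> :: real
  assumes "finite \<J>" and "\<J> \<noteq> {}"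
    and "\<forall>J\<in>\<J>. bounded_jordan_curve J"
    and "mutually_exterior \<J>"
    and "\<delta> > 0"
  shows "\<exists>Q :: csphere \<Rightarrow> csphere.
    is_rational_map Q \<and> attracting_fixed_point_at_infinity Q \<and>
    sphere_hausdorff_dist (curves_interior \<J>) (filled_julia Q) < ennreal \<delta> \<and>
    sphere_hausdorff_dist (curves_union \<J>) (julia Q) < ennreal \<delta> \<and>
    sphere_hausdorff_dist (curves_exterior \<J>) (basin_infinity Q) < ennreal \<delta>"
proof -
  have "\<forall>J\<in>\<J>. \<exists>g. simple_path g \<and> pathfinish g = pathstart g \<and> J = Some ` path_image g"
    using assms(3) unfolding bounded_jordan_curve_def by blast
  then obtain \<gamma> where \<gamma>: "\<And>J. J \<in> \<J> \<Longrightarrow> simple_path (\<gamma> J)"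
    "\<And>J. J \<in> \<J> \<Longrightarrow> pathfinish (\<gamma> J) = pathstart (\<gamma> J)"
    "\<And>J. J \<in> \<J> \<Longrightarrow> J = Some ` path_image (\<gamma> J)"
    by metis
  have comps: "\<Union> (bounded_components J) = Some ` inside (path_image (\<gamma> J))" if "J \<in> \<J>" for J
    using Union_bounded_components_Jordan_curve[OF \<gamma>(1,2)[OF that]]
    by (simp flip: \<gamma>(3)[OF that])
  interpret exterior_Jordan_curves \<J> \<gamma>
  proof
    fix I J assume IJ: "I \<in> \<J>" "J \<in> \<J>" "I \<noteq> J"
    then have "J \<inter> (I \<union> Some ` inside (path_image (\<gamma> I))) = {}"
      using assms(4) comps[OF IJ(1)] unfolding mutually_exterior_def by metis
    then have "Some ` path_image (\<gamma> J) \<inter> Some ` (path_image (\<gamma> I) \<union> inside (path_image (\<gamma> I))) = {}"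
      using \<gamma>(3)[OF IJ(1)] \<gamma>(3)[OF IJ(2)] by (metis image_Un)
    then have "path_image (\<gamma> J) \<inter> (path_image (\<gamma> I) \<union> inside (path_image (\<gamma> I))) = {}"
      by blast
    then show "path_image (\<gamma> J) \<subseteq> outside (path_image (\<gamma> I))"
      using inside_Un_outside[of "path_image (\<gamma> I)"] by blast
  qed (use assms(1,2) \<gamma>(1,2) in auto)
  have "(\<Union>J\<in>\<J>. J) = (\<Union>J\<in>\<J>. Some ` path_image (\<gamma> J))"
    by (intro SUP_cong refl \<gamma>(3))
  then have cu: "curves_union \<J> = Some ` curves"
    by (simp add: curves_union_def curves_def image_UN)
  have ci: "curves_interior \<J> = Some ` interiors"
    unfolding curves_interior_def interiors_def image_UN using comps by auto
  have ce: "curves_exterior \<J> = insert None (Some ` exteriors)"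
  proof -
    have "w \<in> curves_exterior \<J> \<longleftrightarrow> w \<in> insert None (Some ` exteriors)" for w
      unfolding curves_exterior_def cu ci
      using cover interiors_Int_exteriors curves_Int_exteriors by (cases w) auto
    then show ?thesis by blast
  qed
  \<comment> \<open>All distances will be at most \<open>2 * r\<close>, and the strict inequalities leave room.\<close>
  define r where "r = \<delta> / 3"
  have r: "r > 0" "2 * r > 0" "2 * r < \<delta>" using assms(5) by (auto simp: r_def)
  obtain \<epsilon>1 where \<epsilon>1: "\<epsilon>1 > 0" "\<And>x. x \<in> curves \<Longrightarrow> \<exists>y\<in>interiors. dist x y \<le> r \<and> \<epsilon>1 \<le> infdist y curves"
    using uniform_depth_near_boundary[OF compact_curves curves_nonempty
        curves_subset_closure_interiors interiors_Int_curves r(1)] by blast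
  obtain \<epsilon>2 where \<epsilon>2: "\<epsilon>2 > 0" "\<And>x. x \<in> curves \<Longrightarrow> \<exists>y\<in>exteriors. dist x y \<le> r \<and> \<epsilon>2 \<le> infdist y curves"
    using uniform_depth_near_boundary[OF compact_curves curves_nonempty
        curves_subset_closure_exteriors curves_Int_exteriors r(1)] by blast
  have "min r (min \<epsilon>1 \<epsilon>2) > 0" using r \<epsilon>1 \<epsilon>2 by simp
  from this obtain \<epsilon> p q R where \<epsilon>: "0 < \<epsilon>" "\<epsilon> \<le> min r (min \<epsilon>1 \<epsilon>2)" and pq: "q \<noteq> 0" "coprime p q"
    and attr: "attracting_fixed_point_at_infinity (rational_map_of p q)"
    and A: "Some ` {z \<in> interiors. \<epsilon> \<le> infdist z curves} \<subseteq> filled_julia (rational_map_of p q)"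
    and B: "Some ` {z \<in> exteriors. \<epsilon> \<le> infdist z curves} \<subseteq> basin_infinity (rational_map_of p q)"
    and far: "{z. norm z > R} \<subseteq> {z \<in> exteriors. \<epsilon> \<le> infdist z curves}"
    by (rule exists_rational_map_separating_deep_points) (rule that)
  define Q where "Q = rational_map_of p q"
  define K where "K = Some -` filled_julia Q"
  have "(Q ^^ n) None = None" for n
    using attr by (induction n) (auto simp: Q_def attracting_fixed_point_at_infinity_def)
  then have N: "None \<in> basin_infinity Q" by (simp add: basin_infinity_def)
  have fj: "filled_julia Q = Some ` K"
  proof -
    have "w \<in> filled_julia Q \<longleftrightarrow> w \<in> Some ` K" for w
      using N by (cases w) (auto simp: K_def filled_julia_def)
    then show ?thesis by blast
  qed
  have ba: "basin_infinity Q = insert None (Some ` (- K))"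
  proof -
    have "w \<in> basin_infinity Q \<longleftrightarrow> w \<in> insert None (Some ` (- K))" for w
      using N by (cases w) (auto simp: K_def filled_julia_def)
    then show ?thesis by blast
  qed
  have KA: "{z \<in> interiors. \<epsilon> \<le> infdist z curves} \<subseteq> K"
    using A by (auto simp: K_def Q_def)
  have KB: "K \<inter> {z \<in> exteriors. \<epsilon> \<le> infdist z curves} = {}"
    using B by (auto simp: K_def Q_def filled_julia_def)
  have "K \<subseteq> cball 0 R" using KB far by force
  then have bK: "bounded K" using bounded_cball bounded_subset by blast
  have ju: "julia Q = Some ` frontier K"
    unfolding julia_def fj using bK by (rule frontier_of_riemann_sphere_Some)
  have \<epsilon>r: "\<epsilon> \<le> r" using \<epsilon> by simp
  have depthI: "\<exists>y\<in>interiors. dist x y \<le> r \<and> \<epsilon> \<le> infdist y curves" if "x \<in> curves" for x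
    using \<epsilon>1(2)[OF that] \<epsilon> by fastforce
  have depthE: "\<exists>y\<in>exteriors. dist x y \<le> r \<and> \<epsilon> \<le> infdist y curves" if "x \<in> curves" for x
    using \<epsilon>2(2)[OF that] \<epsilon> by fastforce
  have lt: "ennreal (2 * r) < ennreal \<delta>" using r by (simp add: ennreal_less_iff)
  note i = closed_nbhd_of_set_separating_deep_points[OF compact_curves curves_nonempty cover
      \<epsilon>(1) \<epsilon>r depthI KA KB]
  note ii = closed_nbhd_of_frontier_separating_deep_points[OF compact_curves curves_nonempty cover
      open_interiors open_exteriors \<epsilon>(1) \<epsilon>r depthI depthE KA KB]
  have cover': "exteriors \<union> curves \<union> interiors = UNIV" using cover by auto
  have KA': "{z \<in> exteriors. \<epsilon> \<le> infdist z curves} \<subseteq> - K" using KB by auto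
  have KB': "- K \<inter> {z \<in> interiors. \<epsilon> \<le> infdist z curves} = {}" using KA by auto
  note iii = closed_nbhd_of_set_separating_deep_points[OF compact_curves curves_nonempty cover'
      \<epsilon>(1) \<epsilon>r depthE KA' KB']
  have "sphere_hausdorff_dist (curves_interior \<J>) (filled_julia Q) < ennreal \<delta>"
    unfolding ci fj sphere_hausdorff_dist_Some
    using hausdorff_dist_le[OF r(2) i] lt by (rule le_less_trans)
  moreover have "sphere_hausdorff_dist (curves_union \<J>) (julia Q) < ennreal \<delta>"
    unfolding cu ju sphere_hausdorff_dist_Some
    using hausdorff_dist_le[OF r(2) ii] lt by (rule le_less_trans)
  moreover have "sphere_hausdorff_dist (curves_exterior \<J>) (basin_infinity Q) < ennreal \<delta>"
  proof -
    have "{z. norm z > R} \<subseteq> exteriors" using far by auto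
    from sphere_hausdorff_dist_infinity_le[OF r(2) iii this order_trans[OF far KA']] lt
    show ?thesis unfolding ce ba by (rule le_less_trans)
  qed
  moreover have "is_rational_map Q"
    unfolding is_rational_map_def Q_def using pq by blast
  ultimately show ?thesis using attr unfolding Q_def by blast
qed

end
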